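(* Let $n$ and $k$ be positive integers. Then $S_k(n)\equiv 0 \pmod n$ if and only if one of the following holds: (i) $n$ is odd and $p-1\nmid k$ for every prime divisor $p$ of $n$; (ii) $n$ is a multiple of $4$ and $k>1$ is odd.
   Context: For positive integers $n,k$, $S_k(n):=\sum_{j=1}^{n} j^k$. *)

theory Defs
  imports "HOL-Number_Theory.Number_Theory"
begin

definition power_sum :: "nat \<Rightarrow> nat \<Rightarrow> nat" where
  "power_sum k n = (\<Sum>j = 1..n. j ^ k)"

end

theory Submission imports Defs begin

text \<open>
  Reflecting \<open>j \<mapsto> n - j\<close> settles the case of \<open>k\<close> odd and \<open>n\<close> even: all terms cancel or vanish modulo \<open>n\<close>
  except the fixed point \<open>n div 2\<close>, so that the sum is congruent to \<open>(n div 2) ^ k\<close>, which \<open>n\<close>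
  divides exactly when \<open>4 dvd n\<close> and \<open>k > 1\<close> (\<open>power_sum_cong_half\<close>, \<open>dvd_half_power_iff\<close>).

  In every other case \<open>k * (p - 1)\<close> is even for each prime \<open>p\<close> dividing \<open>n\<close>, and the problem can be
  solved one prime at a time. If \<open>p ^ a\<close> is the exact power of \<open>p\<close> in \<open>n\<close>, then the sum up to \<open>n\<close> is
  congruent modulo \<open>p ^ a\<close> to \<open>n div p\<close> times the sum up to \<open>p\<close>
  (\<open>power_sum_cong_at_prime\<close>). This comes from splitting the range \<open>1..p * m\<close> into \<open>p\<close> shifted
  copies of \<open>1..m\<close> and expanding to first order in the shift: the linear terms contain the factor
  \<open>k * (0 + 1 + \<dots> + (p - 1)) = p * (k * (p - 1) div 2)\<close>, where parity makes the cofactor of \<open>p\<close> an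
  integer. As \<open>n div p\<close> has \<open>p\<close>-adic valuation \<open>a - 1\<close>, divisibility of the sum by \<open>p ^ a\<close> amounts
  to \<open>p\<close> dividing the sum up to \<open>p\<close>, and that happens exactly if \<open>p - 1\<close> does not divide \<open>k\<close>, by
  Fermat's theorem in one direction and a primitive root modulo \<open>p\<close> in the other
  (\<open>prime_dvd_power_sum_iff\<close>). For \<open>n\<close> and \<open>k\<close> both even the prime \<open>2\<close> always violates this condition.
\<close>

section \<open>Reflection: odd exponent and even length\<close>

lemma dvd_power_add_power_odd:
  fixes a b k :: nat
  assumes "odd k"
  shows "a + b dvd a ^ k + b ^ k"
proof -
  have "[int a ^ k = (- int b) ^ k] (mod (int a + int b))"
    by (intro cong_pow) (simp add: cong_iff_dvd_diff)
  with assms have "int (a + b) dvd int (a ^ k + b ^ k)"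
    by (simp add: cong_iff_dvd_diff)
  then show ?thesis
    by (simp only: int_dvd_int_iff)
qed

text \<open>
  The terms at \<open>j\<close> and \<open>2 * m - j\<close> cancel modulo \<open>2 * m\<close>. Adding the reversed sum to the whole sum
  would lose a factor \<open>2\<close>, so only the lower half of the range is paired with the upper half.
\<close>
lemma power_sum_cong_half:
  assumes "m > 0" "odd k"
  shows "[power_sum k (2 * m) = m ^ k] (mod (2 * m))"
proof -
  have split: "{1..2 * m} = ({1..<m} \<union> {m<..<2 * m}) \<union> {m, 2 * m}"
    using assms(1) by auto
  have refl: "(\<Sum>j\<in>{m<..<2 * m}. j ^ k) = (\<Sum>j\<in>{1..<m}. (2 * m - j) ^ k)"
    by (rule sum.reindex_bij_witness[of _ "\<lambda>j. 2 * m - j" "\<lambda>j. 2 * m - j"]) auto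
  have "power_sum k (2 * m)
      = (\<Sum>j\<in>{1..<m} \<union> {m<..<2 * m}. j ^ k) + (\<Sum>j\<in>{m, 2 * m}. j ^ k)"
    unfolding power_sum_def split by (intro sum.union_disjoint) auto
  also have "(\<Sum>j\<in>{1..<m} \<union> {m<..<2 * m}. j ^ k)
      = (\<Sum>j\<in>{1..<m}. j ^ k) + (\<Sum>j\<in>{m<..<2 * m}. j ^ k)"
    by (intro sum.union_disjoint) auto
  also have "\<dots> = (\<Sum>j\<in>{1..<m}. j ^ k + (2 * m - j) ^ k)"
    by (simp add: refl sum.distrib)
  also have "(\<Sum>j\<in>{m, 2 * m}. j ^ k) = m ^ k + (2 * m) ^ k"
    using assms(1) by simp
  finally have eq: "power_sum k (2 * m)
      = (\<Sum>j\<in>{1..<m}. j ^ k + (2 * m - j) ^ k) + (m ^ k + (2 * m) ^ k)" .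
  have "2 * m dvd (\<Sum>j\<in>{1..<m}. j ^ k + (2 * m - j) ^ k)"
  proof (rule dvd_sum)
    fix j assume "j \<in> {1..<m}"
    then have "j + (2 * m - j) = 2 * m"
      by auto
    then show "2 * m dvd j ^ k + (2 * m - j) ^ k"
      using dvd_power_add_power_odd[OF assms(2), of j "2 * m - j"] by simp
  qed
  moreover have "2 * m dvd (2 * m) ^ k"
    using assms(2) by (intro dvd_power) (auto elim: oddE)
  ultimately have "[power_sum k (2 * m) = 0 + (m ^ k + 0)] (mod (2 * m))"
    unfolding eq by (intro cong_add cong_refl) (simp_all add: cong_0_iff)
  then show ?thesis
    by simp
qed

lemma dvd_half_power_iff:
  fixes m k :: nat
  assumes "m > 0" "k > 0"
  shows "2 * m dvd m ^ k \<longleftrightarrow> even m \<and> k > 1"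
proof -
  obtain l where k: "k = Suc l"
    using assms(2) gr0_implies_Suc by blast
  have "2 * m dvd m ^ k \<longleftrightarrow> 2 dvd m ^ l"
    using assms(1) unfolding k by (simp add: mult.commute)
  then show ?thesis
    by (auto simp: k)
qed

section \<open>Splitting the range into shifted copies\<close>

lemma power_sum_add:
  "power_sum k (l + m) = power_sum k l + (\<Sum>j = 1..m. (j + l) ^ k)"
proof -
  have "{1..l + m} = {1..l} \<union> {1 + l..m + l}"
    by auto
  then have "power_sum k (l + m) = power_sum k l + (\<Sum>j = 1 + l..m + l. j ^ k)"
    unfolding power_sum_def by (simp add: sum.union_disjoint)
  then show ?thesis
    by (simp only: sum.shift_bounds_cl_nat_ivl)
qed

lemma power_sum_mult_cong:
  "[power_sum k (q * m) = q * power_sum k m] (mod m)"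
proof (induction q)
  case 0
  then show ?case by (simp add: power_sum_def)
next
  case (Suc q)
  have "[(\<Sum>j = 1..m. (j + q * m) ^ k) = power_sum k m] (mod m)"
    unfolding power_sum_def by (intro cong_sum cong_pow) (simp add: cong_def)
  with Suc have "[power_sum k (q * m) + (\<Sum>j = 1..m. (j + q * m) ^ k)
      = q * power_sum k m + power_sum k m] (mod m)"
    by (rule cong_add)
  then show ?case
    using power_sum_add[of k "q * m" m] by (simp add: add.commute)
qed

lemma power_add_cong_linear:
  fixes j y k :: nat
  shows "[(j + y) ^ Suc k = j ^ Suc k + Suc k * y * j ^ k] (mod y\<^sup>2)"
proof (induction k)
  case 0
  then show ?case by simp
next
  case (Suc k)
  have "[(j + y) * (j + y) ^ Suc k = (j + y) * (j ^ Suc k + Suc k * y * j ^ k)] (mod y\<^sup>2)"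
    using Suc by (rule cong_scalar_left)
  also have "(j + y) * (j ^ Suc k + Suc k * y * j ^ k)
      = j ^ Suc (Suc k) + Suc (Suc k) * y * j ^ Suc k + y\<^sup>2 * (Suc k * j ^ k)"
    by (simp add: algebra_simps power2_eq_square)
  also have "[\<dots> = j ^ Suc (Suc k) + Suc (Suc k) * y * j ^ Suc k] (mod y\<^sup>2)"
    by (simp add: cong_def)
  finally show ?case
    by simp
qed

text \<open>
  Each shift \<open>j + i * m\<close> with \<open>i < q\<close> is expanded to first order; all higher terms contain \<open>m\<^sup>2\<close>, and
  the linear ones collect the factor \<open>0 + 1 + \<dots> + (q - 1)\<close>.
\<close>
lemma power_sum_mult_cong_linear:
  "[power_sum (Suc k) (q * m)
    = q * power_sum (Suc k) m + Suc k * (\<Sum>i<q. i) * m * power_sum k m] (mod m\<^sup>2)"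
proof (induction q)
  case 0
  then show ?case by (simp add: power_sum_def)
next
  case (Suc q)
  have "[(\<Sum>j = 1..m. (j + q * m) ^ Suc k)
      = (\<Sum>j = 1..m. j ^ Suc k + Suc k * (q * m) * j ^ k)] (mod m\<^sup>2)"
  proof (intro cong_sum)
    fix j
    have "m\<^sup>2 dvd (q * m)\<^sup>2"
      by (simp add: power_mult_distrib)
    then show "[(j + q * m) ^ Suc k = j ^ Suc k + Suc k * (q * m) * j ^ k] (mod m\<^sup>2)"
      by (rule cong_dvd_modulus_nat[OF power_add_cong_linear])
  qed
  also have "(\<Sum>j = 1..m. j ^ Suc k + Suc k * (q * m) * j ^ k)
      = power_sum (Suc k) m + Suc k * (q * m) * power_sum k m"
    unfolding power_sum_def by (simp only: sum.distrib sum_distrib_left)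
  finally have "[power_sum (Suc k) (q * m) + (\<Sum>j = 1..m. (j + q * m) ^ Suc k)
      = (q * power_sum (Suc k) m + Suc k * (\<Sum>i<q. i) * m * power_sum k m)
        + (power_sum (Suc k) m + Suc k * (q * m) * power_sum k m)] (mod m\<^sup>2)"
    by (rule cong_add[OF Suc])
  moreover have "power_sum (Suc k) (q * m) + (\<Sum>j = 1..m. (j + q * m) ^ Suc k)
      = power_sum (Suc k) (Suc q * m)"
    using power_sum_add[of "Suc k" "q * m" m] by (simp add: add.commute)
  moreover have "(q * power_sum (Suc k) m + Suc k * (\<Sum>i<q. i) * m * power_sum k m)
        + (power_sum (Suc k) m + Suc k * (q * m) * power_sum k m)
      = Suc q * power_sum (Suc k) m + Suc k * (\<Sum>i<Suc q. i) * m * power_sum k m"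
    by (simp add: distrib_left distrib_right)
  ultimately show ?case
    by (simp only:)
qed

text \<open>
  Compared with \<open>power_sum_mult_cong\<close>, a factor \<open>p\<close> is gained in the modulus. Evenness of
  \<open>k * (p - 1)\<close> makes the linear term vanish; for \<open>k = 3\<close> and \<open>p = m = 2\<close> it survives, as the sum up
  to \<open>4\<close> is \<open>100\<close>, which differs from \<open>2 * (1 + 8)\<close> modulo \<open>4\<close>.
\<close>
lemma power_sum_mult_cong_even:
  assumes "k > 0" "even (k * (p - 1))" "p dvd m"
  shows "[power_sum k (p * m) = p * power_sum k m] (mod (p * m))"
proof -
  obtain l where k: "k = Suc l"
    using assms(1) gr0_implies_Suc by blast
  have gauss: "2 * (\<Sum>i<p. i) = p * (p - 1)"
    by (induction p) (auto simp: algebra_simps)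
  obtain c where c: "k * (p - 1) = 2 * c"
    using assms(2) by (elim evenE)
  have "2 * (k * (\<Sum>i<p. i)) = p * (k * (p - 1))"
    using gauss by (metis mult.left_commute)
  then have "k * (\<Sum>i<p. i) = p * c"
    unfolding c by simp
  then have "p * m dvd k * (\<Sum>i<p. i) * m * power_sum l m"
    by simp
  then have "[p * power_sum k m + k * (\<Sum>i<p. i) * m * power_sum l m
      = p * power_sum k m + 0] (mod (p * m))"
    by (intro cong_add cong_refl) (simp only: cong_0_iff)
  moreover have "[power_sum k (p * m)
      = p * power_sum k m + k * (\<Sum>i<p. i) * m * power_sum l m] (mod (p * m))"
    unfolding k
    by (rule cong_dvd_modulus_nat[OF power_sum_mult_cong_linear])
       (use assms(3) in \<open>simp add: power2_eq_square mult_dvd_mono\<close>)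
  ultimately show ?thesis
    by (metis add_0_right cong_trans)
qed

lemma power_sum_prime_power_cong:
  assumes "k > 0" "even (k * (p - 1))"
  shows "[power_sum k (p ^ Suc a) = p ^ a * power_sum k p] (mod (p ^ Suc a))"
proof (induction a)
  case 0
  then show ?case by simp
next
  case (Suc a)
  have "[power_sum k (p * p ^ Suc a) = p * power_sum k (p ^ Suc a)] (mod (p * p ^ Suc a))"
    using assms by (intro power_sum_mult_cong_even) auto
  also have "[p * power_sum k (p ^ Suc a) = p * (p ^ a * power_sum k p)] (mod (p * p ^ Suc a))"
    using Suc by (simp only: cong_def mult_mod_right[symmetric])
  finally show ?case
    by (simp add: mult.assoc)
qed

lemma power_sum_cong_at_prime:
  assumes "k > 0" "even (k * (p - 1))"
  shows "[power_sum k (q * p ^ Suc a) = q * p ^ a * power_sum k p] (mod (p ^ Suc a))"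
proof -
  have "[q * power_sum k (p ^ Suc a) = q * (p ^ a * power_sum k p)] (mod (p ^ Suc a))"
    using power_sum_prime_power_cong[OF assms] by (rule cong_scalar_left)
  with power_sum_mult_cong show ?thesis
    unfolding mult.assoc by (rule cong_trans)
qed

section \<open>Power sums up to a prime\<close>

lemma bij_betw_mult_mod_prime:
  fixes p g :: nat
  assumes "prime p" "coprime p g"
  shows "bij_betw (\<lambda>j. g * j mod p) {1..<p} {1..<p}"
proof -
  have "inj_on (\<lambda>j. g * j mod p) {1..<p}"
  proof (rule inj_onI)
    fix i j assume ij: "i \<in> {1..<p}" "j \<in> {1..<p}" and "g * i mod p = g * j mod p"
    then have "[g * i = g * j] (mod p)"
      by (simp add: cong_def)
    then have "[i = j] (mod p)"
      using assms(2) by (simp add: cong_mult_lcancel_nat coprime_commute)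
    with ij show "i = j"
      by (simp add: cong_def)
  qed
  moreover have "(\<lambda>j. g * j mod p) ` {1..<p} \<subseteq> {1..<p}"
  proof (rule image_subsetI)
    fix j assume j: "j \<in> {1..<p}"
    then have "\<not> p dvd j"
      by (auto dest: dvd_imp_le)
    then have "\<not> p dvd g * j"
      using assms(2) by (simp add: coprime_dvd_mult_right_iff)
    then show "g * j mod p \<in> {1..<p}"
      using prime_gt_0_nat[OF assms(1)] by (auto simp: dvd_eq_mod_eq_0 Suc_le_eq)
  qed
  ultimately show ?thesis
    by (simp add: bij_betw_def endo_inj_surj)
qed

text \<open>
  If \<open>p - 1\<close> divides \<open>k\<close>, the \<open>p - 1\<close> terms below \<open>p\<close> are all \<open>1\<close> modulo \<open>p\<close>. Otherwise take a
  primitive root \<open>g\<close>: multiplication by \<open>g\<close> permutes the nonzero residues, so the sum is unchanged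
  when multiplied by \<open>g ^ k\<close>, which is not \<open>1\<close> modulo \<open>p\<close>; hence the sum vanishes.
\<close>
lemma prime_dvd_power_sum_iff:
  assumes "prime p" "k > 0"
  shows "p dvd power_sum k p \<longleftrightarrow> \<not> (p - 1) dvd k"
proof -
  define T where "T = (\<Sum>j\<in>{1..<p}. j ^ k)"
  have p: "p > 1"
    using assms(1) by (rule prime_gt_1_nat)
  then have "{1..p} = insert p {1..<p}"
    by auto
  then have "power_sum k p = p ^ k + T"
    by (simp add: power_sum_def T_def)
  then have T: "p dvd power_sum k p \<longleftrightarrow> p dvd T"
    using assms(2) by (simp add: dvd_add_right_iff)
  show ?thesis
  proof (cases "(p - 1) dvd k")
    case True
    then obtain c where c: "k = (p - 1) * c"
      by (elim dvdE)
    have "[T = (\<Sum>j\<in>{1..<p}. 1)] (mod p)"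
      unfolding T_def
    proof (rule cong_sum)
      fix j assume "j \<in> {1..<p}"
      then have "\<not> p dvd j"
        by (auto dest: dvd_imp_le)
      with assms(1) have "[(j ^ (p - 1)) ^ c = 1 ^ c] (mod p)"
        by (intro cong_pow fermat_theorem)
      then show "[j ^ k = 1] (mod p)"
        by (simp add: c power_mult)
    qed
    then have "p dvd T \<longleftrightarrow> p dvd p - 1"
      by (simp add: cong_dvd_iff)
    moreover have "\<not> p dvd p - 1"
      using p by (auto dest: dvd_imp_le)
    ultimately show ?thesis
      using T True by simp
  next
    case False
    obtain g where g: "residue_primroot p g"
      using prime_primitive_root_exists[of p] assms(1) p by auto
    then have cop: "coprime p g" and ord: "ord p g = p - 1"
      using assms(1) by (auto simp: residue_primroot_def totient_prime)
    have "T = (\<Sum>j\<in>{1..<p}. (g * j mod p) ^ k)"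
      unfolding T_def using sum.reindex_bij_betw[OF bij_betw_mult_mod_prime[OF assms(1) cop]]
      by (rule sym)
    also have "[\<dots> = (\<Sum>j\<in>{1..<p}. (g * j) ^ k)] (mod p)"
      by (intro cong_sum cong_pow) simp
    also have "(\<Sum>j\<in>{1..<p}. (g * j) ^ k) = g ^ k * T"
      by (simp add: T_def power_mult_distrib sum_distrib_left)
    finally have inv: "[g ^ k * T = 1 * T] (mod p)"
      by (simp add: cong_sym)
    have "p dvd T"
    proof (rule ccontr)
      assume "\<not> p dvd T"
      then have "coprime T p"
        using assms(1) prime_imp_coprime coprime_commute by blast
      with inv have "[g ^ k = 1] (mod p)"
        by (simp only: cong_mult_rcancel_nat)
      with False show False
        using ord_divides[of g k p] ord by simp
    qed
    with T False show ?thesis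
      by simp
  qed
qed

section \<open>Assembling the primes\<close>

text \<open>
  Divisibility by \<open>n\<close> is tested on the exact prime powers of \<open>n\<close>. At each of them all but one of the
  factors \<open>p\<close> come from the multiplicative constant in \<open>power_sum_cong_at_prime\<close>, so only the sum up
  to \<open>p\<close> can supply the last one.
\<close>
lemma dvd_power_sum_iff:
  assumes "n > 0" "k > 0" and even: "\<And>p. prime p \<Longrightarrow> p dvd n \<Longrightarrow> even (k * (p - 1))"
  shows "n dvd power_sum k n \<longleftrightarrow> (\<forall>p. prime p \<and> p dvd n \<longrightarrow> \<not> (p - 1) dvd k)"
proof -
  have local: "p ^ multiplicity p n dvd power_sum k n \<longleftrightarrow> \<not> (p - 1) dvd k"
    if p: "prime p" "p dvd n" for p
  proof -
    obtain q where n: "n = p ^ multiplicity p n * q" and q: "\<not> p dvd q"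
      using multiplicity_decompose'[of n p] assms(1) not_prime_unit p(1) by blast
    have "multiplicity p n > 0"
      using p assms(1) by (simp add: prime_multiplicity_gt_zero_iff)
    then obtain a where a: "multiplicity p n = Suc a"
      using gr0_implies_Suc by blast
    have "[power_sum k n = q * p ^ a * power_sum k p] (mod (p ^ Suc a))"
      using power_sum_cong_at_prime[OF assms(2) even[OF p], of q a] n a by (simp add: mult.commute)
    then have "p ^ Suc a dvd power_sum k n \<longleftrightarrow> p ^ Suc a dvd q * p ^ a * power_sum k p"
      by (rule cong_dvd_iff)
    also have "\<dots> \<longleftrightarrow> p ^ a * p dvd p ^ a * (q * power_sum k p)"
      by (simp add: ac_simps)
    also have "\<dots> \<longleftrightarrow> p dvd q * power_sum k p"
      using prime_gt_0_nat[OF p(1)] by simp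
    also have "\<dots> \<longleftrightarrow> p dvd power_sum k p"
      using q p(1) by (simp add: prime_dvd_mult_iff)
    finally show ?thesis
      using prime_dvd_power_sum_iff[OF p(1) assms(2)] a by simp
  qed
  show ?thesis
  proof
    assume "n dvd power_sum k n"
    then show "\<forall>p. prime p \<and> p dvd n \<longrightarrow> \<not> (p - 1) dvd k"
      using local multiplicity_dvd dvd_trans by blast
  next
    assume cond: "\<forall>p. prime p \<and> p dvd n \<longrightarrow> \<not> (p - 1) dvd k"
    have "n ^ k \<le> power_sum k n"
      unfolding power_sum_def using assms(1) by (intro member_le_sum) auto
    with assms(1) have pos: "power_sum k n \<noteq> 0"
      by (metis le_zero_eq not_gr_zero power_not_zero)
    show "n dvd power_sum k n"
    proof (rule multiplicity_le_imp_dvd)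
      fix p :: nat assume p: "prime p"
      show "multiplicity p n \<le> multiplicity p (power_sum k n)"
      proof (cases "p dvd n")
        case True
        with local cond p have "p ^ multiplicity p n dvd power_sum k n"
          by blast
        with pos p show ?thesis
          by (intro multiplicity_geI) auto
      next
        case False
        then show ?thesis
          by (simp add: not_dvd_imp_multiplicity_0)
      qed
    qed (use assms(1) in simp)
  qed
qed

theorem theorem1:
  fixes n k :: nat
  assumes "n > 0" and "k > 0"
  shows "[power_sum k n = 0] (mod n) \<longleftrightarrow>
    (odd n \<and> (\<forall>p. prime p \<and> p dvd n \<longrightarrow> \<not> (p - 1) dvd k)) \<or>
    (4 dvd n \<and> k > 1 \<and> odd k)"
proof (cases "even n \<and> odd k")
  case True
  then obtain m where m: "n = 2 * m"
    by (auto elim: evenE)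
  with assms(1) have "m > 0"
    by simp
  have "n dvd power_sum k n \<longleftrightarrow> n dvd m ^ k"
    unfolding m using power_sum_cong_half[of m k] \<open>m > 0\<close> True by (intro cong_dvd_iff) simp
  also have "\<dots> \<longleftrightarrow> even m \<and> k > 1"
    unfolding m using \<open>m > 0\<close> assms(2) by (rule dvd_half_power_iff)
  also have "even m \<longleftrightarrow> 4 dvd n"
    unfolding m by presburger
  finally show ?thesis
    using True by (auto simp: cong_0_iff)
next
  case False
  have "even (k * (p - 1))" if "prime p" "p dvd n" for p
  proof (cases "even k")
    case False
    with \<open>\<not> (even n \<and> odd k)\<close> have "odd n"
      by simp
    with that(2) have "odd p"
      by (meson dvd_trans)
    then show ?thesis
      by simp
  qed simp
  from dvd_power_sum_iff[OF assms this]
  have iff: "[power_sum k n = 0] (mod n) \<longleftrightarrow> (\<forall>p. prime p \<and> p dvd n \<longrightarrow> \<not> (p - 1) dvd k)"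
    by (simp add: cong_0_iff)
  \<comment> \<open>For even \<open>n\<close> the prime \<open>2\<close> refutes the right-hand side, since \<open>2 - 1\<close> divides every \<open>k\<close>.\<close>
  have "odd n" if "\<forall>p. prime p \<and> p dvd n \<longrightarrow> \<not> (p - 1) dvd k"
    using that[rule_format, of 2] by auto
  moreover have "odd n" if "4 dvd n \<and> k > 1 \<and> odd k"
    using that False by auto
  moreover have "even n" if "4 dvd n"
    using that by presburger
  ultimately show ?thesis
    using iff by blast
qed

end
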